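(* Let $(\mathcal X,\mathscr F,\widehat{\mathbb P})$ be a probability space, let $f:\mathcal X\to\mathbb R$ be measurable with $\mathbb E_{\widehat{\mathbb P}}[f]>-\infty$, and let $c:\mathcal X\times\mathcal X\to[0,\infty]$ be measurable with $c(x,x)=0$ for all $x\in\mathcal X$. Define $$\overline{\mathcal L}^\circ(\rho):=\sup_{\mathbb P\in\mathcal P(\mathcal X)}\{\mathbb E_{X\sim\mathbb P}[f(X)]:\overline{\mathcal K}_c(\widehat{\mathbb P},\mathbb P)<\rho\},$$ and let $\psi_\rho(\hat x,x):=f(x)$ if $c(\hat x,x)<\rho$ and $\psi_\rho(\hat x,x):=-\infty$ if $c(\hat x,x)\ge\rho$. (1) If $\psi_\rho$ satisfies the interchangeability principle (IP) for some $\rho>0$, then for this $\rho$ $$\overline{\mathcal L}^\circ(\rho)=\mathbb E_{\widehat X\sim\widehat{\mathbb P}}\Big[\sup_x\{f(x):c(\widehat X,x)<\rho\}\Big].$$ (2) If $\psi_\rho$ satisfies (IP) for every $\rho>0$, then for every $\lambda\ge0$ $$(-\overline{\mathcal L})^*(-\lambda)=\sup_{\rho>0}\Big\{\mathbb E_{\widehat X\sim\widehat{\mathbb P}}\Big[\sup_x\{f(x):c(\widehat X,x)<\rho\}-\lambda\rho\Big]\Big\}.$$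
   Context: $\mathcal P(\mathcal X)$ is the set of probability measures on $(\mathcal X,\mathscr F)$; $\Gamma(\widehat{\mathbb P},\mathbb P)$ is the set of probability measures on $(\mathcal X\times\mathcal X,\mathscr F\otimes\mathscr F)$ with marginals $\widehat{\mathbb P}$ and $\mathbb P$; $\Gamma_{\widehat{\mathbb P}}$ is the set of those with first marginal $\widehat{\mathbb P}$. The maximum transport cost is $\overline{\mathcal K}_c(\widehat{\mathbb P},\mathbb P):=\inf_{\gamma\in\Gamma(\widehat{\mathbb P},\mathbb P)}\gamma\text{-}\operatorname{ess\,sup}_{\hat x,x\in\mathcal X}c(\hat x,x)$. The associated robust loss is $\overline{\mathcal L}(\rho):=\sup_{\mathbb P\in\mathcal P(\mathcal X)}\{\mathbb E_{X\sim\mathbb P}[f(X)]:\overline{\mathcal K}_c(\widehat{\mathbb P},\mathbb P)\le\rho\}$, and $(-\overline{\mathcal L})^*(-\lambda)=\sup_{\rho\ge0}\{\overline{\mathcal L}(\rho)-\lambda\rho\}$. Expectations may take values in $\overline{\mathbb R}$; an integral is well defined when the positive or the negative part of the integrand has finite integral. A function is $\widehat{\mathbb P}$-measurable if it is measurable with respect to the completion of $\mathscr F$ under $\widehat{\mathbb P}$. Interchangeability principle (IP): an $(\mathscr F\otimes\mathscr F)$-measurable $\phi:\mathcal X\times\mathcal X\to\mathbb R\cup\{-\infty\}$ satisfies (IP) if $\hat x\mapsto\sup_{x\in\mathcal X}\phi(\hat x,x)$ is $\widehat{\mathbb P}$-measurable and $$\mathbb E_{\widehat X\sim\widehat{\mathbb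 P}}\Big[\sup_{x\in\mathcal X}\phi(\widehat X,x)\Big]=\sup_{\gamma\in\Gamma_{\widehat{\mathbb P}}}\mathbb E_{(\widehat X,X)\sim\gamma}[\phi(\widehat X,X)].$$ *)

theory Defs
  imports "HOL-Probability.Probability"
begin

text \<open>\<^const>\<open>e2ennreal\<close> truncates at 0, so the two integrals are those of the positive and the
  negative part. In \<^typ>\<open>ereal\<close>, \<open>\<infinity> - \<infinity>\<close> evaluates to \<open>\<infinity>\<close>; the value of \<open>ext_expectation\<close> is
  meaningful only under \<open>ext_integrable\<close>.\<close>

definition ext_integrable :: "'a measure \<Rightarrow> ('a \<Rightarrow> ereal) \<Rightarrow> bool" where
  "ext_integrable M g \<longleftrightarrow>
     (\<integral>\<^sup>+x. e2ennreal (g x) \<partial>M) < \<infinity> \<or> (\<integral>\<^sup>+x. e2ennreal (- g x) \<partial>M) < \<infinity>"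

definition ext_expectation :: "'a measure \<Rightarrow> ('a \<Rightarrow> ereal) \<Rightarrow> ereal" where
  "ext_expectation M g =
     enn2ereal (\<integral>\<^sup>+x. e2ennreal (g x) \<partial>M) - enn2ereal (\<integral>\<^sup>+x. e2ennreal (- g x) \<partial>M)"

definition couplings :: "'a measure \<Rightarrow> 'a measure \<Rightarrow> ('a \<times> 'a) measure set" where
  "couplings P Q =
     {\<gamma> \<in> space (prob_algebra (P \<Otimes>\<^sub>M Q)). distr \<gamma> P fst = P \<and> distr \<gamma> Q snd = Q}"

definition first_marginal_couplings :: "'a measure \<Rightarrow> ('a \<times> 'a) measure set" where
  "first_marginal_couplings P = {\<gamma> \<in> space (prob_algebra (P \<Otimes>\<^sub>M P)). distr \<gamma> P fst = P}"

definition max_transport_cost ::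
  "('a \<times> 'a \<Rightarrow> ennreal) \<Rightarrow> 'a measure \<Rightarrow> 'a measure \<Rightarrow> ennreal" where
  "max_transport_cost c P Q = (INF \<gamma>\<in>couplings P Q. esssup \<gamma> c)"

text \<open>The suprema range over the distributions for which the expectation of \<open>f\<close> is well defined.\<close>

definition robust_loss ::
  "'a measure \<Rightarrow> ('a \<Rightarrow> real) \<Rightarrow> ('a \<times> 'a \<Rightarrow> ennreal) \<Rightarrow> real \<Rightarrow> ereal" where
  "robust_loss P f c \<rho> =
     (SUP Q\<in>{Q \<in> space (prob_algebra P). ext_integrable Q (\<lambda>x. ereal (f x)) \<and>
                max_transport_cost c P Q \<le> ennreal \<rho>}.
        ext_expectation Q (\<lambda>x. ereal (f x)))"

definition strict_robust_loss ::
  "'a measure \<Rightarrow> ('a \<Rightarrow> real) \<Rightarrow> ('a \<times> 'a \<Rightarrow> ennreal) \<Rightarrow> real \<Rightarrow> ereal" where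
  "strict_robust_loss P f c \<rho> =
     (SUP Q\<in>{Q \<in> space (prob_algebra P). ext_integrable Q (\<lambda>x. ereal (f x)) \<and>
                max_transport_cost c P Q < ennreal \<rho>}.
        ext_expectation Q (\<lambda>x. ereal (f x)))"

text \<open>The argument \<open>h\<close> is regarded as \<open>+\<infinity>\<close> on the negative reals.\<close>

definition conjugate :: "(real \<Rightarrow> ereal) \<Rightarrow> real \<Rightarrow> ereal" where
  "conjugate h s = (SUP \<rho>\<in>{0..}. ereal (s * \<rho>) - h \<rho>)"

definition interchangeability :: "'a measure \<Rightarrow> ('a \<times> 'a \<Rightarrow> ereal) \<Rightarrow> bool" where
  "interchangeability P \<phi> \<longleftrightarrow>
     \<phi> \<in> borel_measurable (P \<Otimes>\<^sub>M P) \<and>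
     (\<forall>z\<in>space (P \<Otimes>\<^sub>M P). \<phi> z \<noteq> \<infinity>) \<and>
     (\<lambda>y. SUP x\<in>space P. \<phi> (y, x)) \<in> borel_measurable (completion P) \<and>
     ext_integrable (completion P) (\<lambda>y. SUP x\<in>space P. \<phi> (y, x)) \<and>
     ext_expectation (completion P) (\<lambda>y. SUP x\<in>space P. \<phi> (y, x)) =
       (SUP \<gamma>\<in>{\<gamma> \<in> first_marginal_couplings P. ext_integrable \<gamma> \<phi>}. ext_expectation \<gamma> \<phi>)"

definition truncated_loss ::
  "('a \<Rightarrow> real) \<Rightarrow> ('a \<times> 'a \<Rightarrow> ennreal) \<Rightarrow> real \<Rightarrow> 'a \<times> 'a \<Rightarrow> ereal" where
  "truncated_loss f c \<rho> z = (if c z < ennreal \<rho> then ereal (f (snd z)) else -\<infinity>)"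

end

theory Submission
  imports Defs
begin

text \<open>A coupling \<open>\<gamma>\<close> with \<open>c \<le> \<rho>' < \<rho>\<close> almost surely does not see the truncation in the loss,
  which bounds the strict robust loss by the supremum in the interchangeability principle. Conversely, a
  coupling giving the truncated loss an expectation above \<open>-\<infinity>\<close> has only \<open>c < \<rho>\<close> almost surely,
  which is too weak for a strict bound on the transport cost. So fix \<open>r\<^sub>n \<up> \<rho>\<close> and send the mass where
  \<open>c > r\<^sub>n\<close> to the diagonal, where \<open>c\<close> vanishes: the cost drops to \<open>r\<^sub>n\<close>, and the expectations converge
  because the negative part of \<open>f\<close> is integrable under the reference measure. The second claim
  follows from the first, since the non-strict loss at \<open>\<rho>\<close> is at most the strict loss at
  \<open>\<rho> + \<epsilon>\<close>, while the penalty changes by \<open>\<lambda>\<epsilon>\<close> only.\<close>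

section \<open>Expectations with values in the extended reals\<close>

lemma ext_integrable_distr:
  assumes "T \<in> measurable M N" "g \<in> borel_measurable N"
  shows "ext_integrable (distr M N T) g \<longleftrightarrow> ext_integrable M (\<lambda>x. g (T x))"
  using assms by (simp add: ext_integrable_def nn_integral_distr)

lemma ext_expectation_distr:
  assumes "T \<in> measurable M N" "g \<in> borel_measurable N"
  shows "ext_expectation (distr M N T) g = ext_expectation M (\<lambda>x. g (T x))"
  using assms by (simp add: ext_expectation_def nn_integral_distr)

lemma ext_integrable_cong_AE:
  assumes "AE x in M. g x = h x"
  shows "ext_integrable M g \<longleftrightarrow> ext_integrable M h"
proof -
  have "(\<integral>\<^sup>+x. e2ennreal (g x) \<partial>M) = (\<integral>\<^sup>+x. e2ennreal (h x) \<partial>M)"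
    "(\<integral>\<^sup>+x. e2ennreal (- g x) \<partial>M) = (\<integral>\<^sup>+x. e2ennreal (- h x) \<partial>M)"
    using assms by (auto intro!: nn_integral_cong_AE)
  then show ?thesis by (simp add: ext_integrable_def)
qed

lemma ext_expectation_cong_AE:
  assumes "AE x in M. g x = h x"
  shows "ext_expectation M g = ext_expectation M h"
proof -
  have "(\<integral>\<^sup>+x. e2ennreal (g x) \<partial>M) = (\<integral>\<^sup>+x. e2ennreal (h x) \<partial>M)"
    "(\<integral>\<^sup>+x. e2ennreal (- g x) \<partial>M) = (\<integral>\<^sup>+x. e2ennreal (- h x) \<partial>M)"
    using assms by (auto intro!: nn_integral_cong_AE)
  then show ?thesis by (simp add: ext_expectation_def)
qed

lemma ext_expectation_cong:
  "(\<And>x. x \<in> space M \<Longrightarrow> g x = h x) \<Longrightarrow> ext_expectation M g = ext_expectation M h"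
  by (rule ext_expectation_cong_AE) simp

text \<open>If the negative part had infinite integral, well-definedness would make the positive
  part finite and the difference -infinity. Without \<open>ext_integrable\<close>, the convention
  infinity - infinity = infinity could hide an infinite negative part.\<close>

lemma nn_integral_neg_finite:
  assumes "ext_integrable M g" "ext_expectation M g > -\<infinity>"
  shows "(\<integral>\<^sup>+x. e2ennreal (- g x) \<partial>M) < \<infinity>"
proof (rule ccontr)
  assume *: "\<not> ?thesis"
  then have neg: "(\<integral>\<^sup>+x. e2ennreal (- g x) \<partial>M) = top"
    by (simp add: less_top[symmetric])
  then have "(\<integral>\<^sup>+x. e2ennreal (g x) \<partial>M) \<noteq> top"
    using assms(1) by (auto simp: ext_integrable_def)
  then have "enn2ereal (\<integral>\<^sup>+x. e2ennreal (g x) \<partial>M) \<noteq> \<infinity>"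
    by simp
  then show False
    using assms(2) neg
    by (cases "enn2ereal (\<integral>\<^sup>+x. e2ennreal (g x) \<partial>M)") (simp_all add: ext_expectation_def)
qed

text \<open>The balance is a sum identity because that is what additivity of nonnegative integrals
  delivers. All subtracted terms are finite and can be moved across; \<open>a\<close> and
  \<open>a'\<close> may be infinite, but only together.\<close>

lemma enn2ereal_diff_eq_diff:
  assumes "a + b' + k = b + a'" "b < top" "b' < top" "k < top"
  shows "enn2ereal a - enn2ereal b = enn2ereal a' - enn2ereal b' - enn2ereal k"
proof -
  have "enn2ereal a + enn2ereal b' + enn2ereal k = enn2ereal b + enn2ereal a'"
    using assms(1) by (metis plus_ennreal.rep_eq)
  moreover have "enn2ereal b \<noteq> \<infinity>" "enn2ereal b' \<noteq> \<infinity>" "enn2ereal k \<noteq> \<infinity>"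
    using assms(2-4) by auto
  moreover have "enn2ereal b \<noteq> -\<infinity>" "enn2ereal b' \<noteq> -\<infinity>" "enn2ereal k \<noteq> -\<infinity>"
    "enn2ereal a \<noteq> -\<infinity>" "enn2ereal a' \<noteq> -\<infinity>"
    by auto
  ultimately show ?thesis
    by (cases "enn2ereal a"; cases "enn2ereal b"; cases "enn2ereal a'";
        cases "enn2ereal b'"; cases "enn2ereal k") auto
qed

text \<open>The splitting y = y^+ - y^- is applied to x and to x - k, with terms moved so that
  nothing is subtracted in \<open>ennreal\<close>. At infinite x both sides are infinite.\<close>

lemma e2ennreal_diff_balance:
  assumes "0 \<le> k"
  shows "e2ennreal (x - ereal k) + e2ennreal (- x) + ennreal k =
    e2ennreal (- (x - ereal k)) + e2ennreal x"
proof (cases x)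
  case (real r)
  then show ?thesis
    using assms ennreal_plus[of "- r" k] ennreal_plus[of "r - k" k] ennreal_plus[of "k - r" r]
    by (cases "r \<le> 0"; cases "r \<le> k") (auto simp: ennreal_neg add.commute)
qed (simp_all add: e2ennreal_neg)

lemma e2ennreal_uminus_diff_le:
  assumes "0 \<le> k"
  shows "e2ennreal (- (x - ereal k)) \<le> e2ennreal (- x) + ennreal k"
proof (cases x)
  case (real r)
  then show ?thesis
    using assms ennreal_plus[of "- r" k]
    by (cases "r \<le> 0") (auto simp: ennreal_neg intro: ennreal_leI)
qed (simp_all add: e2ennreal_neg)

text \<open>The expectation may be +infinity, so linearity for integrable functions does not cover
  it. Instead the pointwise balance is integrated, and total mass 1 turns the constant into
  \<open>k\<close>.\<close>

lemma (in prob_space) ext_expectation_diff_const: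
  assumes [measurable]: "g \<in> borel_measurable M" and "0 \<le> k"
    and neg: "(\<integral>\<^sup>+x. e2ennreal (- g x) \<partial>M) < \<infinity>"
  shows "ext_expectation M (\<lambda>x. g x - ereal k) = ext_expectation M g - ereal k"
proof -
  have "(\<integral>\<^sup>+x. e2ennreal (- (g x - ereal k)) \<partial>M) \<le> (\<integral>\<^sup>+x. e2ennreal (- g x) + ennreal k \<partial>M)"
    by (intro nn_integral_mono e2ennreal_uminus_diff_le \<open>0 \<le> k\<close>)
  also have "\<dots> = (\<integral>\<^sup>+x. e2ennreal (- g x) \<partial>M) + ennreal k"
    by (simp add: nn_integral_add emeasure_space_1)
  also have "\<dots> < \<infinity>"
    using neg by (simp add: ennreal_add_less_top)
  finally have neg': "(\<integral>\<^sup>+x. e2ennreal (- (g x - ereal k)) \<partial>M) < \<infinity>" .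
  have "(\<integral>\<^sup>+x. e2ennreal (g x - ereal k) \<partial>M) + (\<integral>\<^sup>+x. e2ennreal (- g x) \<partial>M) + ennreal k =
      (\<integral>\<^sup>+x. e2ennreal (g x - ereal k) + e2ennreal (- g x) + ennreal k \<partial>M)"
    by (simp add: nn_integral_add emeasure_space_1)
  also have "\<dots> = (\<integral>\<^sup>+x. e2ennreal (- (g x - ereal k)) + e2ennreal (g x) \<partial>M)"
    by (simp add: e2ennreal_diff_balance[OF \<open>0 \<le> k\<close>])
  also have "\<dots> = (\<integral>\<^sup>+x. e2ennreal (- (g x - ereal k)) \<partial>M) + (\<integral>\<^sup>+x. e2ennreal (g x) \<partial>M)"
    by (simp add: nn_integral_add)
  finally show ?thesis
    using enn2ereal_diff_eq_diff neg neg' \<open>0 \<le> k\<close> unfolding ext_expectation_def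
    by (metis enn2ereal_ennreal ennreal_less_top infinity_ennreal_def)
qed

section \<open>The truncated loss and the upper bound on the strict robust loss\<close>

lemma SUP_truncated_loss:
  assumes "y \<in> space P" "c (y, y) = 0" "0 < \<rho>"
  shows "(SUP x\<in>space P. truncated_loss f c \<rho> (y, x)) =
    (SUP x\<in>{x \<in> space P. c (y, x) < ennreal \<rho>}. ereal (f x))"
proof (rule antisym)
  show "(SUP x\<in>space P. truncated_loss f c \<rho> (y, x)) \<le>
      (SUP x\<in>{x \<in> space P. c (y, x) < ennreal \<rho>}. ereal (f x))"
    unfolding truncated_loss_def by (rule SUP_least) (auto intro: SUP_upper)
  show "(SUP x\<in>{x \<in> space P. c (y, x) < ennreal \<rho>}. ereal (f x)) \<le>
      (SUP x\<in>space P. truncated_loss f c \<rho> (y, x))"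
  proof (rule SUP_least)
    fix x assume "x \<in> {x \<in> space P. c (y, x) < ennreal \<rho>}"
    then show "ereal (f x) \<le> (SUP x\<in>space P. truncated_loss f c \<rho> (y, x))"
      by (intro SUP_upper2[of x]) (auto simp: truncated_loss_def)
  qed
qed

lemma strict_robust_loss_le_SUP:
  fixes c :: "'a \<times> 'a \<Rightarrow> ennreal"
  assumes [measurable]: "f \<in> borel_measurable P" "c \<in> borel_measurable (P \<Otimes>\<^sub>M P)"
  shows "strict_robust_loss P f c \<rho> \<le>
    (SUP \<gamma>\<in>{\<gamma> \<in> first_marginal_couplings P. ext_integrable \<gamma> (truncated_loss f c \<rho>)}.
      ext_expectation \<gamma> (truncated_loss f c \<rho>))"
  unfolding strict_robust_loss_def
proof (rule SUP_least)
  fix Q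
  assume "Q \<in> {Q \<in> space (prob_algebra P). ext_integrable Q (\<lambda>x. ereal (f x)) \<and>
    max_transport_cost c P Q < ennreal \<rho>}"
  then have Q: "sets Q = sets P" "ext_integrable Q (\<lambda>x. ereal (f x))"
    "max_transport_cost c P Q < ennreal \<rho>"
    by (auto simp: space_prob_algebra)
  \<comment> \<open>The infimum over couplings need not be attained, but a strict bound on it is met
    by some coupling.\<close>
  then obtain \<gamma> where \<gamma>: "\<gamma> \<in> couplings P Q" "esssup \<gamma> c < ennreal \<rho>"
    unfolding max_transport_cost_def INF_less_iff by auto
  have [measurable_cong]: "sets Q = sets P" by fact
  have "sets (P \<Otimes>\<^sub>M Q) = sets (P \<Otimes>\<^sub>M P)"
    by (simp add: Q(1) cong: sets_pair_measure_cong)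
  then have \<gamma>_sets[measurable_cong]: "sets \<gamma> = sets (P \<Otimes>\<^sub>M P)"
    and \<gamma>1: "\<gamma> \<in> first_marginal_couplings P" and snd: "distr \<gamma> Q snd = Q"
    using \<gamma>(1) by (auto simp: couplings_def first_marginal_couplings_def space_prob_algebra)
  have "AE z in \<gamma>. truncated_loss f c \<rho> z = ereal (f (snd z))"
    using esssup_AE[of c \<gamma>] by eventually_elim (use \<gamma>(2) in \<open>auto simp: truncated_loss_def\<close>)
  then have "ext_integrable \<gamma> (truncated_loss f c \<rho>) \<longleftrightarrow> ext_integrable (distr \<gamma> Q snd) (\<lambda>x. ereal (f x))"
    "ext_expectation \<gamma> (truncated_loss f c \<rho>) = ext_expectation (distr \<gamma> Q snd) (\<lambda>x. ereal (f x))"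
    by (simp_all add: ext_integrable_distr ext_expectation_distr
        ext_integrable_cong_AE[where M = \<gamma> and g = "truncated_loss f c \<rho>"]
        ext_expectation_cong_AE[where M = \<gamma> and g = "truncated_loss f c \<rho>"])
  then show "ext_expectation Q (\<lambda>x. ereal (f x)) \<le>
    (SUP \<gamma>\<in>{\<gamma> \<in> first_marginal_couplings P. ext_integrable \<gamma> (truncated_loss f c \<rho>)}.
      ext_expectation \<gamma> (truncated_loss f c \<rho>))"
    using \<gamma>1 Q(2) snd by (intro SUP_upper2[of \<gamma>]) auto
qed

section \<open>Redirecting mass to the diagonal and the lower bound\<close>

definition redirect :: "('a \<times> 'a \<Rightarrow> ennreal) \<Rightarrow> real \<Rightarrow> 'a \<times> 'a \<Rightarrow> 'a" where
  "redirect c r z = (if c z \<le> ennreal r then snd z else fst z)"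

lemma redirect_measurable [measurable]:
  assumes [measurable]: "c \<in> borel_measurable (P \<Otimes>\<^sub>M P)"
  shows "redirect c r \<in> measurable (P \<Otimes>\<^sub>M P) P"
  unfolding redirect_def by measurable

text \<open>Keeping the first coordinate and redirecting the second gives a coupling whose first
  marginal is still \<open>P\<close>. Its cost is at most \<open>r\<close> at every point: either
  the pair is kept because \<open>c\<close> is at most \<open>r\<close> there, or it lands on the
  diagonal.\<close>

lemma max_transport_cost_redirect:
  assumes \<gamma>: "\<gamma> \<in> first_marginal_couplings P"
    and [measurable]: "c \<in> borel_measurable (P \<Otimes>\<^sub>M P)"
    and diag: "\<And>x. x \<in> space P \<Longrightarrow> c (x, x) = 0"
  shows "distr \<gamma> P (redirect c r) \<in> space (prob_algebra P)"
    and "max_transport_cost c P (distr \<gamma> P (redirect c r)) \<le> ennreal r"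
proof -
  have sets_\<gamma>[measurable_cong]: "sets \<gamma> = sets (P \<Otimes>\<^sub>M P)" and fst_\<gamma>: "distr \<gamma> P fst = P"
    and "prob_space \<gamma>"
    using \<gamma> by (auto simp: first_marginal_couplings_def space_prob_algebra)
  interpret \<gamma>: prob_space \<gamma> by fact
  define Q where "Q = distr \<gamma> P (redirect c r)"
  define \<gamma>' where "\<gamma>' = distr \<gamma> (P \<Otimes>\<^sub>M P) (\<lambda>z. (fst z, redirect c r z))"
  have [measurable_cong]: "sets Q = sets P" by (simp add: Q_def)
  show "distr \<gamma> P (redirect c r) \<in> space (prob_algebra P)"
    by (auto simp: space_prob_algebra intro!: \<gamma>.prob_space_distr)
  have "sets (P \<Otimes>\<^sub>M Q) = sets (P \<Otimes>\<^sub>M P)"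
    by (simp add: Q_def cong: sets_pair_measure_cong)
  moreover have "prob_space \<gamma>'"
    unfolding \<gamma>'_def by (intro \<gamma>.prob_space_distr) measurable
  moreover have "distr \<gamma>' P fst = P" "distr \<gamma>' Q snd = Q"
    unfolding \<gamma>'_def by (simp_all add: distr_distr comp_def fst_\<gamma> Q_def cong: distr_cong)
  ultimately have coupling: "\<gamma>' \<in> couplings P Q"
    by (auto simp: couplings_def space_prob_algebra \<gamma>'_def)
  have "AE z in \<gamma>'. c z \<le> ennreal r"
    unfolding \<gamma>'_def
  proof (subst AE_distr_iff)
    show "AE z in \<gamma>. c (fst z, redirect c r z) \<le> ennreal r"
      using sets_eq_imp_space_eq[OF sets_\<gamma>]
      by (intro AE_I2) (auto simp: redirect_def diag space_pair_measure)
  qed measurable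
  then have "esssup \<gamma>' c \<le> ennreal r"
    by (intro esssup_I) (simp_all add: \<gamma>'_def)
  then show "max_transport_cost c P (distr \<gamma> P (redirect c r)) \<le> ennreal r"
    using coupling unfolding Q_def max_transport_cost_def by (auto intro: INF_lower2)
qed

lemma SUP_le_strict_robust_loss:
  fixes c :: "'a \<times> 'a \<Rightarrow> ennreal"
  assumes [measurable]: "f \<in> borel_measurable P" "c \<in> borel_measurable (P \<Otimes>\<^sub>M P)"
    and diag: "\<And>x. x \<in> space P \<Longrightarrow> c (x, x) = 0"
    and f_neg: "(\<integral>\<^sup>+x. ennreal (- f x) \<partial>P) < \<infinity>"
    and "0 < \<rho>"
  shows "(SUP \<gamma>\<in>{\<gamma> \<in> first_marginal_couplings P. ext_integrable \<gamma> (truncated_loss f c \<rho>)}.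
      ext_expectation \<gamma> (truncated_loss f c \<rho>)) \<le> strict_robust_loss P f c \<rho>"
proof (rule SUP_least)
  let ?\<psi> = "truncated_loss f c \<rho>"
  fix \<gamma>
  assume "\<gamma> \<in> {\<gamma> \<in> first_marginal_couplings P. ext_integrable \<gamma> ?\<psi>}"
  then have \<gamma>: "\<gamma> \<in> first_marginal_couplings P" and int: "ext_integrable \<gamma> ?\<psi>" by auto
  then have [measurable_cong]: "sets \<gamma> = sets (P \<Otimes>\<^sub>M P)" and fst_\<gamma>: "distr \<gamma> P fst = P"
    by (auto simp: first_marginal_couplings_def space_prob_algebra)
  have [measurable]: "?\<psi> \<in> borel_measurable (P \<Otimes>\<^sub>M P)"
    unfolding truncated_loss_def[abs_def] by measurable
  show "ext_expectation \<gamma> ?\<psi> \<le> strict_robust_loss P f c \<rho>"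
  proof (cases "ext_expectation \<gamma> ?\<psi> = -\<infinity>")
    case False
    then have \<psi>_neg: "(\<integral>\<^sup>+z. e2ennreal (- ?\<psi> z) \<partial>\<gamma>) < \<infinity>"
      using int by (intro nn_integral_neg_finite) auto
    \<comment> \<open>Where \<open>c\<close> is at least \<open>\<rho>\<close> the negative part of
      the truncated loss is infinite, so finiteness of its integral makes this set null.\<close>
    have AE_c: "AE z in \<gamma>. c z < ennreal \<rho>"
    proof -
      have "AE z in \<gamma>. e2ennreal (- ?\<psi> z) \<noteq> \<infinity>"
        using \<psi>_neg by (intro nn_integral_PInf_AE) auto
      then show ?thesis
        by eventually_elim (auto simp: truncated_loss_def split: if_splits)
    qed
    \<comment> \<open>Starts at 0 and stays strictly below \<open>\<rho>\<close>; with
      \<open>n\<close> in place of \<open>Suc n\<close>, division by zero would give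
      \<open>\<rho>\<close> itself at 0.\<close>
    define r where "r n = \<rho> - \<rho> / (Suc n)" for n
    have r_less: "r n < \<rho>" for n
      using \<open>0 < \<rho>\<close> by (simp add: r_def)
    have r_mono: "r m \<le> r n" if "m \<le> n" for m n
      using that \<open>0 < \<rho>\<close> by (simp add: r_def frac_le)
    have "r \<longlonglongrightarrow> \<rho> - 0"
      unfolding r_def
      by (intro tendsto_diff tendsto_const) (use LIMSEQ_Suc[OF lim_const_over_n[of \<rho>]] in simp)
    then have r_lim: "(\<lambda>n. ennreal (r n)) \<longlonglongrightarrow> ennreal \<rho>"
      by (intro tendsto_ennrealI) simp
    have ev_r: "\<forall>\<^sub>F n in sequentially. c z \<le> ennreal (r n)" if "c z < ennreal \<rho>" for z
      using order_tendstoD(1)[OF r_lim that] by eventually_elim simp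
    \<comment> \<open>\<open>u\<close> is the gain on the kept mass, \<open>v\<close> the loss on
      the redirected mass. Positive values of \<open>f\<close> on redirected mass are discarded,
      which makes \<open>u\<close> increasing in \<open>n\<close>, so monotone convergence
      applies.\<close>
    define u where "u n z = (if c z \<le> ennreal (r n) then ennreal (f (snd z)) else 0)" for n z
    define v where "v n z = (if c z \<le> ennreal (r n) then 0 else ennreal (- f (fst z)))" for n z
    have [measurable]: "u n \<in> borel_measurable \<gamma>" "v n \<in> borel_measurable \<gamma>" for n
      unfolding u_def[abs_def] v_def[abs_def] by measurable
    have u_lim: "(\<lambda>n. \<integral>\<^sup>+z. u n z \<partial>\<gamma>) \<longlonglongrightarrow> (\<integral>\<^sup>+z. e2ennreal (?\<psi> z) \<partial>\<gamma>)"
    proof (rule nn_integral_LIMSEQ)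
      show "incseq u"
        unfolding incseq_def le_fun_def u_def
        using order_trans[OF _ ennreal_leI[OF r_mono]] by auto
      show "(\<lambda>n. u n z) \<longlonglongrightarrow> e2ennreal (?\<psi> z)" for z
      proof (cases "c z < ennreal \<rho>")
        case True
        have "\<forall>\<^sub>F n in sequentially. u n z = e2ennreal (?\<psi> z)"
          using ev_r[OF True] by eventually_elim (simp add: u_def truncated_loss_def True)
        then show ?thesis by (rule tendsto_eventually)
      next
        case False
        moreover have "\<not> c z \<le> ennreal (r n)" for n
          using False ennreal_lessI[OF \<open>0 < \<rho>\<close> r_less[of n]] by auto
        ultimately show ?thesis
          by (simp add: u_def truncated_loss_def e2ennreal_neg)
      qed
    qed simp
    have fst_neg: "(\<integral>\<^sup>+z. ennreal (- f (fst z)) \<partial>\<gamma>) < \<infinity>"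
    proof -
      have "(\<integral>\<^sup>+z. ennreal (- f (fst z)) \<partial>\<gamma>) = (\<integral>\<^sup>+x. ennreal (- f x) \<partial>distr \<gamma> P fst)"
        by (subst nn_integral_distr) auto
      then show ?thesis using f_neg by (simp add: fst_\<gamma>)
    qed
    \<comment> \<open>Unlike \<open>u\<close>, \<open>v\<close> converges only almost everywhere:
      where \<open>c\<close> is at least \<open>\<rho>\<close> it does not depend on
      \<open>n\<close>. The dominating function has a finite integral because
      \<open>\<gamma>\<close> has first marginal \<open>P\<close>.\<close>
    have v_lim: "(\<lambda>n. \<integral>\<^sup>+z. v n z \<partial>\<gamma>) \<longlonglongrightarrow> (\<integral>\<^sup>+z. 0 \<partial>\<gamma>)"
    proof (rule nn_integral_dominated_convergence[where w = "\<lambda>z. ennreal (- f (fst z))"])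
      show "AE z in \<gamma>. (\<lambda>n. v n z) \<longlonglongrightarrow> 0"
        using AE_c
      proof eventually_elim
        case (elim z)
        have "\<forall>\<^sub>F n in sequentially. v n z = 0"
          using ev_r[OF elim] by eventually_elim (simp add: v_def)
        then show ?case by (rule tendsto_eventually)
      qed
    qed (use fst_neg in \<open>auto simp: v_def\<close>)
    have bound: "enn2ereal (\<integral>\<^sup>+z. u n z \<partial>\<gamma>) -
        enn2ereal ((\<integral>\<^sup>+z. e2ennreal (- ?\<psi> z) \<partial>\<gamma>) + (\<integral>\<^sup>+z. v n z \<partial>\<gamma>)) \<le> strict_robust_loss P f c \<rho>"
      for n
    proof -
      define Q where "Q = distr \<gamma> P (redirect c (r n))"
      have "max_transport_cost c P Q \<le> ennreal (r n)"
        unfolding Q_def by (rule max_transport_cost_redirect) (use \<gamma> diag in auto)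
      also have "\<dots> < ennreal \<rho>"
        by (rule ennreal_lessI[OF \<open>0 < \<rho>\<close> r_less])
      finally have cost: "max_transport_cost c P Q < ennreal \<rho>" .
      have Q_prob: "Q \<in> space (prob_algebra P)"
        unfolding Q_def by (rule max_transport_cost_redirect) (use \<gamma> diag in auto)
      \<comment> \<open>Discarding gains can only lower the positive part. The negative part under
        \<open>Q\<close> is bounded by that of the truncated loss on kept mass and by
        \<open>v\<close> on redirected mass.\<close>
      have pos: "(\<integral>\<^sup>+z. u n z \<partial>\<gamma>) \<le> (\<integral>\<^sup>+x. e2ennreal (ereal (f x)) \<partial>Q)"
        unfolding Q_def
        by (subst nn_integral_distr) (auto intro!: nn_integral_mono simp: u_def redirect_def)
      have "(\<integral>\<^sup>+x. e2ennreal (- ereal (f x)) \<partial>Q) \<le> (\<integral>\<^sup>+z. e2ennreal (- ?\<psi> z) + v n z \<partial>\<gamma>)"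
        unfolding Q_def
        by (subst nn_integral_distr)
           (auto intro!: nn_integral_mono simp: v_def redirect_def truncated_loss_def)
      then have neg: "(\<integral>\<^sup>+x. e2ennreal (- ereal (f x)) \<partial>Q) \<le>
          (\<integral>\<^sup>+z. e2ennreal (- ?\<psi> z) \<partial>\<gamma>) + (\<integral>\<^sup>+z. v n z \<partial>\<gamma>)"
        by (simp add: nn_integral_add)
      also have "\<dots> < \<infinity>"
      proof -
        have "(\<integral>\<^sup>+z. v n z \<partial>\<gamma>) \<le> (\<integral>\<^sup>+z. ennreal (- f (fst z)) \<partial>\<gamma>)"
          by (intro nn_integral_mono) (simp add: v_def)
        then show ?thesis using \<psi>_neg fst_neg by (auto simp: less_top[symmetric] top_unique)
      qed
      finally have "ext_integrable Q (\<lambda>x. ereal (f x))"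
        by (simp add: ext_integrable_def)
      then have "ext_expectation Q (\<lambda>x. ereal (f x)) \<le> strict_robust_loss P f c \<rho>"
        unfolding strict_robust_loss_def using Q_prob cost by (intro SUP_upper) auto
      moreover have "enn2ereal (\<integral>\<^sup>+z. u n z \<partial>\<gamma>) -
          enn2ereal ((\<integral>\<^sup>+z. e2ennreal (- ?\<psi> z) \<partial>\<gamma>) + (\<integral>\<^sup>+z. v n z \<partial>\<gamma>)) \<le>
          ext_expectation Q (\<lambda>x. ereal (f x))"
        unfolding ext_expectation_def
        using pos neg by (intro ereal_minus_mono) (simp_all add: less_eq_ennreal.rep_eq)
      ultimately show ?thesis by (rule order_trans[rotated])
    qed
    have "(\<lambda>n. (\<integral>\<^sup>+z. e2ennreal (- ?\<psi> z) \<partial>\<gamma>) + (\<integral>\<^sup>+z. v n z \<partial>\<gamma>))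
        \<longlonglongrightarrow> (\<integral>\<^sup>+z. e2ennreal (- ?\<psi> z) \<partial>\<gamma>) + 0"
      using v_lim by (intro tendsto_add tendsto_const) simp
    \<comment> \<open>The subtracted integrals have a finite limit, so the difference is continuous
      there even if the first limit is infinite.\<close>
    then have "(\<lambda>n. enn2ereal (\<integral>\<^sup>+z. u n z \<partial>\<gamma>) -
        enn2ereal ((\<integral>\<^sup>+z. e2ennreal (- ?\<psi> z) \<partial>\<gamma>) + (\<integral>\<^sup>+z. v n z \<partial>\<gamma>)))
        \<longlonglongrightarrow> enn2ereal (\<integral>\<^sup>+z. e2ennreal (?\<psi> z) \<partial>\<gamma>) - enn2ereal (\<integral>\<^sup>+z. e2ennreal (- ?\<psi> z) \<partial>\<gamma>)"
      using u_lim \<psi>_neg by (intro tendsto_diff_ereal_general) auto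
    then show ?thesis
      unfolding ext_expectation_def[of \<gamma>] by (rule LIMSEQ_le_const2) (use bound in auto)
  qed simp
qed

section \<open>The conjugate in terms of the strict robust loss\<close>

lemma strict_robust_loss_le_robust_loss: "strict_robust_loss P f c \<rho> \<le> robust_loss P f c \<rho>"
  unfolding strict_robust_loss_def robust_loss_def by (rule SUP_subset_mono) auto

lemma robust_loss_le_strict_robust_loss:
  assumes "\<rho> < \<rho>'" "0 < \<rho>'"
  shows "robust_loss P f c \<rho> \<le> strict_robust_loss P f c \<rho>'"
  unfolding strict_robust_loss_def robust_loss_def
  using ennreal_lessI[OF assms(2,1)] by (intro SUP_subset_mono) auto

lemma conjugate_robust_loss:
  assumes "0 \<le> l"
  shows "conjugate (\<lambda>\<rho>. - robust_loss P f c \<rho>) (- l) =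
    (SUP \<rho>\<in>{0<..}. strict_robust_loss P f c \<rho> - ereal (l * \<rho>))" (is "?L = ?R")
proof (rule antisym)
  have eq: "ereal (- l * \<rho>) - (- robust_loss P f c \<rho>) = robust_loss P f c \<rho> - ereal (l * \<rho>)"
    for \<rho>
    by (cases "robust_loss P f c \<rho>") auto
  show "?L \<le> ?R"
    unfolding conjugate_def eq
  proof (rule SUP_least)
    fix \<rho> :: real assume "\<rho> \<in> {0..}"
    show "robust_loss P f c \<rho> - ereal (l * \<rho>) \<le> ?R"
    proof (rule ereal_le_epsilon2)
      fix e :: real assume "0 < e"
      \<comment> \<open>The denominator \<open>l + 1\<close> keeps \<open>d\<close> positive and
        finite for \<open>l = 0\<close>. A positive \<open>d\<close> also moves the radius 0,
        present only on the left, into the range on the right.\<close>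
      define d where "d = e / (l + 1)"
      have d: "0 < d" "l * d \<le> e"
        using \<open>0 < e\<close> \<open>0 \<le> l\<close> by (auto simp: d_def field_simps)
      have "robust_loss P f c \<rho> - ereal (l * \<rho>) \<le>
          strict_robust_loss P f c (\<rho> + d) - ereal (l * \<rho>)"
        using \<open>\<rho> \<in> {0..}\<close> d
        by (intro ereal_minus_mono robust_loss_le_strict_robust_loss) auto
      also have "\<dots> = strict_robust_loss P f c (\<rho> + d) - ereal (l * (\<rho> + d)) + ereal (l * d)"
        by (cases "strict_robust_loss P f c (\<rho> + d)") (auto simp: algebra_simps)
      also have "\<dots> \<le> ?R + ereal e"
        using \<open>\<rho> \<in> {0..}\<close> d by (intro add_mono SUP_upper) auto
      finally show "robust_loss P f c \<rho> - ereal (l * \<rho>) \<le> ?R + ereal e" .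
    qed
  qed
  show "?R \<le> ?L"
    unfolding conjugate_def eq
    by (intro SUP_mono bexI ereal_minus_mono order_refl)
       (auto simp: strict_robust_loss_le_robust_loss)
qed

section \<open>Both claims from the interchangeability principle\<close>

theorem proposition3:
  fixes P :: "'a measure" and f :: "'a \<Rightarrow> real" and c :: "'a \<times> 'a \<Rightarrow> ennreal"
  assumes "prob_space P"
    and "f \<in> borel_measurable P"
    and "ext_integrable P (\<lambda>x. ereal (f x))"
    and "ext_expectation P (\<lambda>x. ereal (f x)) > -\<infinity>"
    and "c \<in> borel_measurable (P \<Otimes>\<^sub>M P)"
    and "\<And>x. x \<in> space P \<Longrightarrow> c (x, x) = 0"
  shows "(\<forall>\<rho>>0. interchangeability P (truncated_loss f c \<rho>) \<longrightarrow>
            strict_robust_loss P f c \<rho> =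
              ext_expectation (completion P)
                (\<lambda>y. SUP x\<in>{x \<in> space P. c (y, x) < ennreal \<rho>}. ereal (f x))) \<and>
         ((\<forall>\<rho>>0. interchangeability P (truncated_loss f c \<rho>)) \<longrightarrow>
           (\<forall>l\<ge>0. conjugate (\<lambda>\<rho>. - robust_loss P f c \<rho>) (- l) =
              (SUP \<rho>\<in>{0<..}. ext_expectation (completion P)
                 (\<lambda>y. (SUP x\<in>{x \<in> space P. c (y, x) < ennreal \<rho>}. ereal (f x))
                        - ereal (l * \<rho>)))))"
proof -
  note [measurable] = assms(2,5)
  interpret prob_space P by fact
  interpret cP: prob_space "completion P" by (rule prob_space_completion)
  let ?S = "\<lambda>\<rho> y. SUP x\<in>{x \<in> space P. c (y, x) < ennreal \<rho>}. ereal (f x)"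
  have f_neg: "(\<integral>\<^sup>+x. ennreal (- f x) \<partial>P) < \<infinity>"
    using nn_integral_neg_finite[OF assms(3,4)] by simp
  have S_eq: "(SUP x\<in>space P. truncated_loss f c \<rho> (y, x)) = ?S \<rho> y"
    if "y \<in> space P" "0 < \<rho>" for y \<rho>
    using that assms(6) by (intro SUP_truncated_loss) auto
  have strict: "strict_robust_loss P f c \<rho> = ext_expectation (completion P) (?S \<rho>)"
    if "0 < \<rho>" and IP: "interchangeability P (truncated_loss f c \<rho>)" for \<rho>
  proof -
    have "strict_robust_loss P f c \<rho> =
        (SUP \<gamma>\<in>{\<gamma> \<in> first_marginal_couplings P. ext_integrable \<gamma> (truncated_loss f c \<rho>)}.
          ext_expectation \<gamma> (truncated_loss f c \<rho>))"
      using f_neg assms(6) \<open>0 < \<rho>\<close>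
      by (intro antisym strict_robust_loss_le_SUP SUP_le_strict_robust_loss) auto
    also have "\<dots> = ext_expectation (completion P) (\<lambda>y. SUP x\<in>space P. truncated_loss f c \<rho> (y, x))"
      using IP by (simp add: interchangeability_def)
    also have "\<dots> = ext_expectation (completion P) (?S \<rho>)"
      using S_eq \<open>0 < \<rho>\<close> by (intro ext_expectation_cong) auto
    finally show ?thesis .
  qed
  \<comment> \<open>Moves the penalty out of the expectation. The supremum is measurable only for
    the completion, hence the use of \<open>cP\<close>.\<close>
  have shift: "ext_expectation (completion P) (\<lambda>y. ?S \<rho> y - ereal (l * \<rho>)) =
      ext_expectation (completion P) (?S \<rho>) - ereal (l * \<rho>)"
    if "0 < \<rho>" "0 \<le> l" and IP: "interchangeability P (truncated_loss f c \<rho>)" for l \<rho>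
  proof (rule cP.ext_expectation_diff_const)
    show "?S \<rho> \<in> borel_measurable (completion P)"
      using IP S_eq \<open>0 < \<rho>\<close> unfolding interchangeability_def
      by (subst measurable_cong[where g = "\<lambda>y. SUP x\<in>space P. truncated_loss f c \<rho> (y, x)"]) auto
    have "(\<integral>\<^sup>+y. e2ennreal (- ?S \<rho> y) \<partial>completion P) \<le> (\<integral>\<^sup>+y. ennreal (- f y) \<partial>completion P)"
    proof (rule nn_integral_mono)
      fix y assume "y \<in> space (completion P)"
      \<comment> \<open>The point \<open>y\<close> itself competes in the supremum, since its cost
        to itself is 0; so the negative part is dominated by that of \<open>f\<close>.\<close>
      then have "ereal (f y) \<le> ?S \<rho> y"
        using assms(6) \<open>0 < \<rho>\<close> by (intro SUP_upper) auto
      then have "e2ennreal (- ?S \<rho> y) \<le> e2ennreal (- ereal (f y))"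
        by (intro e2ennreal_mono) (simp only: ereal_minus_le_minus)
      then show "e2ennreal (- ?S \<rho> y) \<le> ennreal (- f y)" by simp
    qed
    then show "(\<integral>\<^sup>+y. e2ennreal (- ?S \<rho> y) \<partial>completion P) < \<infinity>"
      using f_neg by (simp add: nn_integral_completion)
  qed (use that in auto)
  show ?thesis
  proof (intro conjI allI impI)
    fix l :: real
    assume "\<forall>\<rho>>0. interchangeability P (truncated_loss f c \<rho>)" "0 \<le> l"
    then show "conjugate (\<lambda>\<rho>. - robust_loss P f c \<rho>) (- l) =
        (SUP \<rho>\<in>{0<..}. ext_expectation (completion P) (\<lambda>y. ?S \<rho> y - ereal (l * \<rho>)))"
      unfolding conjugate_robust_loss[OF \<open>0 \<le> l\<close>]
      by (intro SUP_cong refl) (simp add: strict shift)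
  qed (use strict in auto)
qed

end
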